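(* Let $k \geq 3$ and $n \geq k$ be integers. Then three elements of order $k$ suffice to generate $\Sigma_n$ when $k$ is even, and three elements of order $k$ suffice to generate $\mathrm{A}_n$ when $k$ is odd. Further, let $k \geq 3$ and $n \geq k+2$ be integers. Then four elements of order $k$ suffice to generate $\mathrm{A}_n$ when $k$ is even.
   Context: $\Sigma_n$ is the symmetric group on $n$ symbols and $\mathrm{A}_n$ is the alternating group on $n$ symbols. "$m$ elements of order $k$ suffice to generate $G$" means that $G$ has a generating set consisting of at most $m$ elements, each of order exactly $k$. *)

theory Defs
  imports "HOL-Algebra.Sym_Groups" "HOL-Algebra.Multiplicative_Group"
begin

(* "m elements of order k suffice to generate G".  The finiteness of S must be stated, because
   card S = 0 for infinite S. *)
definition elements_of_order_suffice ::
    "nat \<Rightarrow> nat \<Rightarrow> ('a, 'b) monoid_scheme \<Rightarrow> bool"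
  where "elements_of_order_suffice m k G \<longleftrightarrow>
    (\<exists>S \<subseteq> carrier G. finite S \<and> card S \<le> m \<and>
       (\<forall>x\<in>S. group.ord G x = k) \<and> generate G S = carrier G)"

end

(* Call points a, b linked if they are equal or lie on a common three-cycle of the group H. This is
   an H-invariant equivalence relation, and H contains the alternating group once all points are
   linked. The generators are products of k-cycles (and possibly one transposition) on consecutive
   intervals: two of them yield a three-cycle linking 1 and 2, as a quotient or a commutator of a
   k-cycle and its conjugate by the transposition (1 2); the others bridge the gaps between the
   intervals. Each generator used for bridging sends 1 to 1 or 2, hence preserves the class of 1,
   which therefore grows to everything. For even k, one of the three generators is a single k-cycle
   and thus odd. *)

theory Submission
  imports Defs
begin

section \<open>Orders of permutations\<close>

text \<open>A group-free form of order exactly \<open>k\<close> (for positive \<open>k\<close>), so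
  that one computation serves both the symmetric and the alternating group.\<close>

definition has_order :: "nat \<Rightarrow> ('a \<Rightarrow> 'a) \<Rightarrow> bool"
  where "has_order k p \<longleftrightarrow> p ^^ k = id \<and> (\<forall>j. 0 < j \<and> j < k \<longrightarrow> p ^^ j \<noteq> id)"

lemma group_ord_eq_if_has_order:
  assumes G: "group G" and mult: "mult G = (\<circ>)" and one: "one G = id"
    and p: "p \<in> carrier G" and ord: "has_order k p" and k: "k > 0"
  shows "group.ord G p = k"
proof -
  interpret group G by (rule G)
  have pow: "p [^]\<^bsub>G\<^esub> j = p ^^ j" for j :: nat
    by (induction j) (simp_all add: mult one funpow_swap1 fun_eq_iff)
  have dvd_iff: "p ^^ j = id \<longleftrightarrow> ord p dvd j" for j :: nat
    using pow_eq_id[OF p, of j] by (simp add: pow one)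
  have "ord p dvd k"
    using dvd_iff[of k] ord by (simp add: has_order_def)
  moreover from this k have "0 < ord p" and "ord p \<le> k"
    by (auto intro: dvd_imp_le Nat.gr0I)
  moreover have "\<not> ord p < k"
    using ord dvd_iff[of "ord p"] \<open>0 < ord p\<close> by (auto simp: has_order_def)
  ultimately show ?thesis by simp
qed

text \<open>The iterates take the single point \<open>s\<close> through \<open>k\<close> distinct
  points, which rules out every smaller positive exponent.\<close>

lemma has_orderI:
  fixes p :: "nat \<Rightarrow> nat"
  assumes "p ^^ k = id" "\<And>j. j < k \<Longrightarrow> (p ^^ j) s = s + j"
  shows "has_order k p"
  unfolding has_order_def
proof (intro conjI allI impI notI)
  fix j assume "0 < j \<and> j < k" "p ^^ j = id"
  with assms(2)[of j] show False by simp
qed (rule assms(1))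

lemma funpow_conj_involution:
  assumes "t \<circ> t = id"
  shows "(t \<circ> p \<circ> t) ^^ j = t \<circ> p ^^ j \<circ> t"
proof (induction j)
  case 0
  then show ?case using assms by simp
next
  case (Suc j)
  have "t (t x) = x" for x
    using assms by (metis comp_apply id_apply)
  then show ?case
    using Suc by (simp add: fun_eq_iff)
qed

lemma has_order_conj_involution:
  assumes t: "t \<circ> t = id" and p: "has_order k p"
  shows "has_order k (t \<circ> p \<circ> t)"
proof -
  have tt: "t (t x) = x" for x
    using t by (metis comp_apply id_apply)
  have "p ^^ j = id" if "t \<circ> p ^^ j \<circ> t = id" for j
  proof
    fix x
    from that have "t ((p ^^ j) (t (t x))) = t x"
      by (metis comp_apply id_apply)
    then show "(p ^^ j) x = id x"
      by (metis tt id_apply)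
  qed
  moreover have "t \<circ> p ^^ k \<circ> t = id"
    using p t by (simp add: has_order_def)
  ultimately show ?thesis
    using p unfolding has_order_def funpow_conj_involution[OF t] by blast
qed

lemma permutes_disjoint_commute:
  assumes p: "p permutes A" and q: "q permutes B" and AB: "A \<inter> B = {}"
  shows "p \<circ> q = q \<circ> p"
proof
  fix x
  consider "x \<in> A" | "x \<in> B" | "x \<notin> A" "x \<notin> B" by blast
  then show "(p \<circ> q) x = (q \<circ> p) x"
  proof cases
    case 1
    then have "p x \<in> A" using p by (simp add: permutes_in_image)
    with 1 AB q show ?thesis by (simp add: permutes_not_in disjoint_iff)
  next
    case 2
    then have "q x \<in> B" using q by (simp add: permutes_in_image)
    with 2 AB p show ?thesis by (metis comp_apply disjoint_iff permutes_not_in)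
  next
    case 3
    with p q show ?thesis by (simp add: permutes_not_in)
  qed
qed

lemma funpow_comp_if_commute:
  assumes "p \<circ> q = q \<circ> p"
  shows "(p \<circ> q) ^^ j = p ^^ j \<circ> q ^^ j"
proof (induction j)
  case (Suc j)
  have *: "p (q x) = q (p x)" for x
    using assms by (metis comp_apply)
  have "q ((p ^^ j) x) = (p ^^ j) (q x)" for x
    by (induction j) (simp_all add: *[symmetric])
  then show ?case
    using Suc by (simp add: fun_eq_iff)
qed simp


section \<open>Products of consecutive cycles\<close>

definition interval_cycle :: "nat \<Rightarrow> nat \<Rightarrow> nat \<Rightarrow> nat"
  where "interval_cycle s k = cycle_of_list [s..<s+k]"

text \<open>Writing the length as \<open>Suc k\<close> makes \<open>s + k\<close> the last point,
  without subtraction. The induction splits off the transposition of \<open>s\<close> and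
  \<open>Suc s\<close>.\<close>

lemma interval_cycle_apply:
  "interval_cycle s (Suc k) i =
     (if s \<le> i \<and> i < s + k then Suc i else if i = s + k then s else i)"
proof (induction k arbitrary: s i)
  case 0
  then show ?case by (simp add: interval_cycle_def)
next
  case (Suc k)
  have "[s..<s + Suc (Suc k)] = s # Suc s # [Suc (Suc s)..<s + Suc (Suc k)]"
    by (simp add: upt_conv_Cons)
  moreover have "[Suc s..<Suc s + Suc k] = Suc s # [Suc (Suc s)..<s + Suc (Suc k)]"
    by (simp add: upt_conv_Cons)
  ultimately have "interval_cycle s (Suc (Suc k))
      = transpose s (Suc s) \<circ> interval_cycle (Suc s) (Suc k)"
    by (simp add: interval_cycle_def)
  then show ?case
    using Suc[of "Suc s" i] by (auto simp: transpose_def)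
qed

lemma interval_cycle_permutes: "interval_cycle s k permutes {s..<s+k}"
  using cycle_permutes[of "[s..<s+k]"] by (simp add: interval_cycle_def)

lemma permutation_interval_cycle: "permutation (interval_cycle s k)"
  by (simp add: interval_cycle_def permutation_of_cycle)

lemma interval_cycle_funpow: "interval_cycle s k ^^ k = id"
  using cycle_is_id_root[of "[s..<s+k]"] by (simp add: interval_cycle_def)

text \<open>A cycle of length \<open>k\<close> is a product of \<open>k - 1\<close> transpositions.
  For \<open>k = 0\<close> the identity would be even although 0 is not odd.\<close>

lemma evenperm_interval_cycle:
  assumes "k > 0"
  shows "evenperm (interval_cycle s k) \<longleftrightarrow> odd k"
proof -
  have "swapidseq (k - 1) (interval_cycle s k)"
    using swapidseq_ext_imp_swapidseq[OF swapidseq_ext_of_cycles[of "[s..<s+k]"]]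
    by (simp add: interval_cycle_def)
  then show ?thesis
    using assms by (simp add: evenperm_unique)
qed

text \<open>Packing disjoint cycles of length \<open>k\<close> into one element lets an element of
  order \<open>k\<close> act on intervals much longer than \<open>k\<close>.\<close>

fun block_cycle :: "nat \<Rightarrow> nat \<Rightarrow> nat \<Rightarrow> nat \<Rightarrow> nat"
  where
    "block_cycle s k 0 = id"
  | "block_cycle s k (Suc q) = interval_cycle s k \<circ> block_cycle (s + k) k q"

lemma block_cycle_permutes: "block_cycle s k q permutes {s..<s + q * k}"
proof (induction q arbitrary: s)
  case 0
  show ?case unfolding block_cycle.simps by (rule permutes_id)
next
  case (Suc q)
  have "interval_cycle s k permutes {s..<s + Suc q * k}"
    by (rule permutes_subset[OF interval_cycle_permutes]) auto
  moreover have "block_cycle (s + k) k q permutes {s..<s + Suc q * k}"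
    by (rule permutes_subset[OF Suc]) auto
  ultimately show ?case unfolding block_cycle.simps by (rule permutes_compose[rotated])
qed

lemma block_cycle_fixes: "i < s \<or> s + q * k \<le> i \<Longrightarrow> block_cycle s k q i = i"
  using permutes_not_in[OF block_cycle_permutes] by fastforce

lemma block_cycle_commute:
  "interval_cycle s k \<circ> block_cycle (s + k) k q = block_cycle (s + k) k q \<circ> interval_cycle s k"
  by (rule permutes_disjoint_commute[OF interval_cycle_permutes block_cycle_permutes]) auto

lemma block_cycle_funpow: "block_cycle s k q ^^ k = id"
proof (induction q arbitrary: s)
  case 0
  show ?case unfolding block_cycle.simps by (rule id_funpow)
next
  case (Suc q)
  then show ?case
    unfolding block_cycle.simps funpow_comp_if_commute[OF block_cycle_commute]
    by (simp add: interval_cycle_funpow)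
qed

lemma permutation_block_cycle: "permutation (block_cycle s k q)"
  using block_cycle_permutes by (meson finite_atLeastLessThan permutation_permutes)

lemma evenperm_block_cycle:
  assumes "k > 0"
  shows "evenperm (block_cycle s k q) \<longleftrightarrow> odd k \<or> even q"
proof (induction q arbitrary: s)
  case (Suc q)
  then show ?case
    unfolding block_cycle.simps evenperm_comp[OF permutation_interval_cycle permutation_block_cycle]
    using assms by (auto simp: evenperm_interval_cycle)
qed simp

text \<open>The divisibility hypothesis says that \<open>i\<close> is not the last point of its
  block; only there does a cycle jump back.\<close>

lemma block_cycle_apply:
  assumes "s \<le> i" "Suc i < s + q * k" "\<not> k dvd (Suc i - s)"
  shows "block_cycle s k q i = Suc i"
  using assms
proof (induction q arbitrary: s)
  case (Suc q)
  from Suc.prems have "k \<noteq> 0" by (cases k) auto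
  then obtain k' where k': "k = Suc k'" by (cases k) auto
  show ?case
  proof (cases "i < s + k")
    case True
    have "i \<noteq> s + k'"
      using Suc.prems(3) k' by auto
    with True Suc.prems show ?thesis
      by (auto simp: block_cycle_fixes interval_cycle_apply k')
  next
    case False
    then have "Suc i - s = Suc i - (s + k) + k" by simp
    with Suc.prems(3) have "\<not> k dvd (Suc i - (s + k))"
      by (metis dvd_add_triv_right_iff)
    then have "block_cycle (s + k) k q i = Suc i"
      using False Suc.prems(2) by (intro Suc.IH) (auto simp: algebra_simps)
    with False show ?thesis
      by (auto simp: interval_cycle_apply k')
  qed
qed simp

lemma block_cycle_funpow_start:
  assumes "j < k" "0 < q"
  shows "(block_cycle s k q ^^ j) s = s + j"
  using assms(1)
proof (induction j)
  case (Suc j)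
  have "k \<le> q * k" using assms(2) by (cases q) auto
  with Suc.prems have "Suc j < q * k" by linarith
  moreover have "\<not> k dvd Suc j" using Suc.prems by (auto dest: dvd_imp_le)
  ultimately have "block_cycle s k q (s + j) = Suc (s + j)"
    by (intro block_cycle_apply) auto
  with Suc show ?case by simp
qed simp

lemma has_order_block_cycle:
  assumes "0 < q"
  shows "has_order k (block_cycle s k q)"
  by (rule has_orderI[OF block_cycle_funpow block_cycle_funpow_start[OF _ assms]])

section \<open>Correcting the parity by a disjoint transposition\<close>

lemma transpose_funpow_even:
  assumes "even k" shows "transpose u v ^^ k = id"
proof -
  obtain m where "k = 2 * m" using assms by (rule evenE)
  moreover have "transpose u v ^^ (2 * m) = id"
    by (induction m) (simp_all add: fun_eq_iff)
  ultimately show ?thesis by simp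
qed

lemma block_cycle_transpose_commute:
  assumes "u < s \<or> s + q * k \<le> u" "v < s \<or> s + q * k \<le> v"
  shows "block_cycle s k q \<circ> transpose u v = transpose u v \<circ> block_cycle s k q"
  by (rule permutes_disjoint_commute[OF block_cycle_permutes permutes_swap_id[of u "{u,v}" v]])
    (use assms in auto)

text \<open>A transposition has order dividing the even number \<open>k\<close>, so it can change
  the parity and leave the order alone. The orbit of \<open>s\<close> avoids \<open>u\<close> and
  \<open>v\<close> and again excludes smaller exponents.\<close>

lemma has_order_block_cycle_transpose:
  assumes "0 < q" "even k" "u < s \<or> s + q * k \<le> u" "v < s \<or> s + q * k \<le> v"
  shows "has_order k (block_cycle s k q \<circ> transpose u v)"
proof -
  note comm = funpow_comp_if_commute[OF block_cycle_transpose_commute[OF assms(3,4)]]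
  have "(block_cycle s k q \<circ> transpose u v) ^^ k = id"
    by (simp add: comm block_cycle_funpow transpose_funpow_even[OF assms(2)])
  moreover have "((block_cycle s k q \<circ> transpose u v) ^^ j) s = s + j" if "j < k" for j
  proof -
    have "s \<noteq> u" "s \<noteq> v" using assms that by (cases q; auto)+
    then have "(transpose u v ^^ j) s = s"
      by (induction j) auto
    then show ?thesis
      by (simp add: comm block_cycle_funpow_start[OF that assms(1)])
  qed
  ultimately show ?thesis by (rule has_orderI)
qed

lemma evenperm_block_cycle_transpose:
  assumes "k > 0" "even k" "u \<noteq> v"
  shows "evenperm (block_cycle s k q \<circ> transpose u v) \<longleftrightarrow> odd q"
  using assms by (simp add: evenperm_comp permutation_block_cycle evenperm_block_cycle
      permutation_swap_id evenperm_swap)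

lemma block_cycle_transpose_apply:
  assumes "i \<noteq> u" "i \<noteq> v" "s \<le> i" "Suc i < s + q * k" "\<not> k dvd (Suc i - s)"
  shows "(block_cycle s k q \<circ> transpose u v) i = Suc i"
  using assms by (simp add: block_cycle_apply)


section \<open>Subgroups containing the alternating group\<close>

abbreviation tricycle :: "nat \<Rightarrow> nat \<Rightarrow> nat \<Rightarrow> nat \<Rightarrow> nat"
  where "tricycle a b c \<equiv> cycle_of_list [a, b, c]"

locale sym_subgroup =
  fixes n :: nat and H :: "(nat \<Rightarrow> nat) set"
  assumes sub: "subgroup H (sym_group n)"
begin

lemma permutes: "g \<in> H \<Longrightarrow> g permutes {1..n}"
  using subgroup.mem_carrier[OF sub] by (simp add: sym_group_carrier)

lemma comp_closed: "g \<in> H \<Longrightarrow> h \<in> H \<Longrightarrow> g \<circ> h \<in> H"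
  using subgroup.m_closed[OF sub] by (simp add: sym_group_mult)

lemma inv_closed: "g \<in> H \<Longrightarrow> inv' g \<in> H"
  using subgroup.m_inv_closed[OF sub] subgroup.mem_carrier[OF sub] by fastforce

lemma inv_apply:
  assumes "g \<in> H" shows "inv' g (g x) = x" "g (inv' g x) = x"
  using permutes_inverses[OF permutes[OF assms]] by auto

text \<open>Quotients and commutators can thus be placed in \<open>H\<close> through equations
  without inverses, which can be checked pointwise.\<close>

lemma in_if_comp_eq:
  assumes "g \<in> H" "h \<in> H" "t \<circ> g = h" shows "t \<in> H"
proof -
  have "t = h \<circ> inv' g"
    using assms inv_apply[OF assms(1)] by (metis comp_assoc comp_id fun_eq_iff comp_apply id_apply)
  then show ?thesis using assms comp_closed inv_closed by simp
qed

section \<open>Linking points by three-cycles\<close>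

definition tri :: "nat \<Rightarrow> nat \<Rightarrow> nat \<Rightarrow> bool"
  where "tri a b c \<longleftrightarrow> distinct [a, b, c] \<and> tricycle a b c \<in> H"

lemma tri_rotate: "tri a b c \<Longrightarrow> tri b c a"
  using cycle_of_list_rotate_independent[of "[a, b, c]" 1] by (auto simp: tri_def)

text \<open>Exchanging two points inverts the three-cycle. Together with \<open>tri_rotate\<close>
  this makes the order of the three points irrelevant.\<close>

lemma tri_swap:
  assumes "tri a b c" shows "tri b a c"
proof -
  have "inv' (tricycle a b c) = tricycle b a c"
    by (rule inv_unique_comp)
      (use assms in \<open>auto simp: fun_eq_iff tri_def transpose_def\<close>)
  then show ?thesis using assms inv_closed by (fastforce simp: tri_def)
qed

lemma tri_image:
  assumes "g \<in> H" "tri a b c" shows "tri (g a) (g b) (g c)"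
proof -
  have bij: "bij g"
    using permutes[OF assms(1)] by (rule permutes_bij)
  have "g \<circ> tricycle a b c \<circ> inv' g = tricycle (g a) (g b) (g c)"
    using conjugation_of_cycle[OF _ bij, of "[a, b, c]"] assms(2) by (simp add: tri_def)
  moreover have "g \<circ> tricycle a b c \<circ> inv' g \<in> H"
    using assms by (simp add: tri_def comp_closed inv_closed del: cycle_of_list.simps)
  ultimately show ?thesis
    using assms(2) bij by (auto simp: tri_def bij_def inj_eq simp del: cycle_of_list.simps)
qed

lemma tri_tri:
  assumes "tri a b c" "tri x y z"
  shows "tri (tricycle a b c x) (tricycle a b c y) (tricycle a b c z)"
  by (rule tri_image[OF _ assms(2)]) (use assms(1) in \<open>simp add: tri_def del: cycle_of_list.simps\<close>)

definition linked :: "nat \<Rightarrow> nat \<Rightarrow> bool"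
  where "linked a b \<longleftrightarrow> a = b \<or> (\<exists>c. tri a b c)"

lemma linked_refl: "linked a a"
  by (simp add: linked_def)

lemma linked_sym: "linked a b \<Longrightarrow> linked b a"
  using tri_swap by (auto simp: linked_def)

lemma linked_image: "g \<in> H \<Longrightarrow> linked a b \<Longrightarrow> linked (g a) (g b)"
  unfolding linked_def using tri_image by blast

text \<open>If \<^term>\<open>tri a b d\<close> and \<^term>\<open>c\<close> is none of \<^term>\<open>a\<close>, \<^term>\<open>b\<close>, \<^term>\<open>d\<close>,
  then the inverse three-cycle fixes \<^term>\<open>c\<close> and moves \<^term>\<open>b\<close> to \<^term>\<open>a\<close>.\<close>

lemma linked_trans:
  assumes "linked a b" "linked b c" shows "linked a c"
proof (cases "a = b \<or> b = c \<or> a = c")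
  case True
  then show ?thesis using assms by (auto simp: linked_refl)
next
  case False
  then obtain d where d: "tri a b d" using assms(1) by (auto simp: linked_def)
  show ?thesis
  proof (cases "c = d")
    case True
    then show ?thesis using d tri_rotate tri_swap unfolding linked_def by blast
  next
    case c: False
    have "tricycle b a d \<in> H" and "distinct [a, b, d]"
      using tri_swap[OF d] d by (simp_all add: tri_def)
    from linked_image[OF this(1) assms(2)] this(2) show ?thesis
      using False c by (simp add: transpose_def)
  qed
qed

text \<open>If a three-cycle through \<open>d\<close> and \<open>c\<close> avoids \<open>a\<close>
  and \<open>b\<close>, conjugation by it replaces \<open>d\<close> by \<open>c\<close>. If its
  third point is \<open>a\<close> or \<open>b\<close>, that point is displaced to \<open>d\<close>;
  a second conjugation, by a three-cycle on \<open>a\<close>, \<open>b\<close>, \<open>d\<close>,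
  restores the pair \<open>a\<close>, \<open>b\<close> up to order and fixes
  \<open>c\<close>.\<close>

lemma tri_exchange:
  assumes d: "tri a b d" and c: "linked d c" "c \<noteq> a" "c \<noteq> b"
  shows "tri a b c"
proof (cases "c = d")
  case False
  then obtain e where e: "tri d c e" using c(1) by (auto simp: linked_def)
  have dist: "distinct [a, b, d]" "distinct [d, c, e]"
    using d e by (simp_all add: tri_def)
  consider "e = a" | "e = b" | "e \<noteq> a" "e \<noteq> b" by blast
  then show ?thesis
  proof cases
    case 1
    have "tri d b c"
      using tri_tri[OF e d] dist c 1 False by (simp add: transpose_def split: if_splits)
    from tri_tri[OF tri_swap[OF d] this] have "tri b a c"
      using dist c False by (simp add: transpose_def split: if_splits)
    then show ?thesis by (rule tri_swap)
  next
    case 2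
    have "tri d a c"
      using tri_tri[OF e tri_swap[OF d]] dist c 2 False
      by (simp add: transpose_def split: if_splits)
    from tri_tri[OF d this] show ?thesis
      using dist c False by (simp add: transpose_def split: if_splits)
  next
    case 3
    from tri_tri[OF e d] show ?thesis
      using dist c 3 False by (simp add: transpose_def split: if_splits)
  qed
qed (use d in simp)

text \<open>Three-cycles generate the alternating group. Given a three-cycle on \<open>a\<close>,
  \<open>b\<close>, \<open>c\<close>, linking \<open>a\<close> and \<open>b\<close> provides some
  third point, which \<open>tri_exchange\<close> replaces by \<open>c\<close>.\<close>

lemma alt_group_subset_if_linked:
  assumes linked: "\<And>a b. a \<in> {1..n} \<Longrightarrow> b \<in> {1..n} \<Longrightarrow> linked a b"
  shows "carrier (alt_group n) \<subseteq> H"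
proof -
  have "three_cycles n \<subseteq> H"
  proof
    fix p assume "p \<in> three_cycles n"
    then obtain cs where cs: "p = cycle_of_list cs" "cycle cs" "length cs = 3" "set cs \<subseteq> {1..n}"
      by auto
    then obtain a b c where abc: "cs = [a, b, c]"
      using stupid_lemma[OF cs(3)] by auto
    with cs obtain d where d: "tri a b d"
      using linked[of a b] by (auto simp: linked_def)
    \<comment> \<open>The hypothesis concerns points of \<open>{1..n}\<close> only. A third point
      outside would be fixed by all members of \<open>H\<close>, whereas the three-cycle sends it to
      \<open>a\<close>.\<close>
    have "d \<in> {1..n}"
    proof (rule ccontr)
      assume "d \<notin> {1..n}"
      moreover have "tricycle a b d permutes {1..n}" "distinct [a, b, d]"
        using d permutes by (auto simp: tri_def simp del: cycle_of_list.simps)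
      ultimately have "tricycle a b d d = d" "distinct [a, b, d]"
        by (auto simp: permutes_not_in simp del: cycle_of_list.simps)
      then show False by (simp add: transpose_def split: if_splits)
    qed
    then have "tri a b c"
      using tri_exchange[OF d linked] cs abc by auto
    then show "p \<in> H" using cs abc by (simp add: tri_def)
  qed
  moreover have "three_cycles n \<subseteq> carrier (alt_group n)" by (rule three_cycles_incl)
  ultimately have "generate (sym_group n) (three_cycles n) \<subseteq> H"
    by (intro group.generate_subgroup_incl[OF sym_group_is_group _ sub])
  moreover have "generate (alt_group n) (three_cycles n) = generate (sym_group n) (three_cycles n)"
    using group.generate_consistent[OF sym_group_is_group three_cycles_incl alt_group_is_subgroup]
    by (simp add: alt_group_def)
  ultimately show ?thesis
    by (simp add: alt_group_carrier_as_three_cycles)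
qed

text \<open>An element moving 1 to 1 or 2 preserves the class of 1 under \<^const>\<open>linked\<close>, so the
  assumption on \<^term>\<open>i\<close> extends this class from \<^term>\<open>i\<close> to \<^term>\<open>Suc i\<close>.\<close>

lemma alt_group_subset:
  assumes linked: "linked 1 2"
    and step: "\<And>i. 1 \<le> i \<Longrightarrow> i < n \<Longrightarrow> \<exists>g\<in>H. g 1 \<in> {1, 2} \<and> g i = Suc i"
  shows "carrier (alt_group n) \<subseteq> H"
proof (rule alt_group_subset_if_linked)
  have *: "linked 1 (Suc i)" if "Suc i \<le> n" for i
    using that
  proof (induction i)
    case 0
    then show ?case by (simp add: linked_refl)
  next
    case (Suc i)
    then obtain g where g: "g \<in> H" "g 1 \<in> {1, 2}" "g (Suc i) = Suc (Suc i)"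
      using step[of "Suc i"] by auto
    have "linked (g 1) (g (Suc i))"
      using Suc by (intro linked_image[OF g(1)]) simp
    moreover have "linked 1 (g 1)"
      using g linked linked_refl by auto
    ultimately show ?case using g linked_trans by metis
  qed
  then have "linked 1 a" if "a \<in> {1..n}" for a
    using that by (cases a) auto
  then show "linked a b" if "a \<in> {1..n}" "b \<in> {1..n}" for a b
    using that linked_sym linked_trans by blast
qed

text \<open>An odd \<open>q\<close> times the odd \<open>p\<close> is even, hence lies in
  \<open>H\<close>, and \<open>p\<close> can be cancelled.\<close>

lemma sym_group_subset_if_odd:
  assumes "carrier (alt_group n) \<subseteq> H" "p \<in> H" "\<not> evenperm p"
  shows "carrier (sym_group n) \<subseteq> H"
proof
  fix q assume "q \<in> carrier (sym_group n)"
  then have q: "q permutes {1..n}" by (simp add: sym_group_carrier)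
  have p: "p permutes {1..n}" using assms permutes by blast
  show "q \<in> H"
  proof (cases "evenperm q")
    case True
    then show ?thesis using q assms by (auto simp: alt_group_carrier)
  next
    case False
    have "permutation p" "permutation q"
      using p q by (auto simp: permutation_permutes)
    then have "evenperm (q \<circ> p)"
      using False assms by (simp add: evenperm_comp)
    then have "q \<circ> p \<in> H"
      using assms(1) permutes_compose[OF p q] by (auto simp: alt_group_carrier)
    then show ?thesis using in_if_comp_eq assms(2) by blast
  qed
qed

end

text \<open>Conjugation by \<open>x\<close> turns the transposition of \<open>a\<close>,
  \<open>b\<close> into that of \<open>b\<close>, \<open>c\<close>. Hence the conjugate of
  \<open>x\<close> by the former, divided by \<open>x\<close>, is the product of these two
  transpositions, which is the three-cycle.\<close>

lemma conj_transpose_eq: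
  assumes "bij x" "x a = b" "x b = c" "distinct [a, b, c]"
  shows "tricycle a b c \<circ> x = transpose a b \<circ> x \<circ> transpose a b"
proof -
  have "x i = b \<longleftrightarrow> i = a" "x i = c \<longleftrightarrow> i = b" for i
    using assms by (metis bij_pointE)+
  moreover have "(tricycle a b c \<circ> x) i = (transpose a b \<circ> x \<circ> transpose a b) i" for i
    using assms calculation[of i] by (cases "i = a"; cases "i = b"; auto simp: transpose_def)
  ultimately show ?thesis by blast
qed

section \<open>Reduction to generation inside the symmetric group\<close>

lemma elements_of_order_suffice_sym:
  assumes S: "finite S" "card S \<le> m" "S \<subseteq> carrier (sym_group n)"
    and k: "k > 0" "\<And>x. x \<in> S \<Longrightarrow> has_order k x"
    and gen: "carrier (sym_group n) \<subseteq> generate (sym_group n) S"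
  shows "elements_of_order_suffice m k (sym_group n)"
proof -
  have "group.ord (sym_group n) x = k" if "x \<in> S" for x
    using group_ord_eq_if_has_order[OF sym_group_is_group sym_group_mult sym_group_one] that S k
    by blast
  moreover have "generate (sym_group n) S = carrier (sym_group n)"
    using gen group.generate_incl[OF sym_group_is_group S(3)] by blast
  ultimately show ?thesis
    unfolding elements_of_order_suffice_def using S by blast
qed

text \<open>Generation is assumed in \<open>sym_group n\<close>, where the subgroup arguments take
  place; a subset of the alternating group generates the same elements in both groups.\<close>

lemma elements_of_order_suffice_alt:
  assumes S: "finite S" "card S \<le> m" "S \<subseteq> carrier (alt_group n)"
    and k: "k > 0" "\<And>x. x \<in> S \<Longrightarrow> has_order k x"
    and gen: "carrier (alt_group n) \<subseteq> generate (sym_group n) S"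
  shows "elements_of_order_suffice m k (alt_group n)"
proof -
  have "group.ord (alt_group n) x = k" if "x \<in> S" for x
    using group_ord_eq_if_has_order[OF alt_group_is_group alt_group_mult alt_group_one] that S k
    by blast
  moreover have "generate (alt_group n) S = generate (sym_group n) S"
    using group.generate_consistent[OF sym_group_is_group S(3) alt_group_is_subgroup]
    by (simp add: alt_group_def)
  then have "generate (alt_group n) S = carrier (alt_group n)"
    using gen group.generate_incl[OF alt_group_is_group S(3)] by blast
  ultimately show ?thesis
    unfolding elements_of_order_suffice_def using S by blast
qed


section \<open>Generators\<close>

lemma sym_subgroup_generate:
  "S \<subseteq> carrier (sym_group n) \<Longrightarrow> sym_subgroup n (generate (sym_group n) S)"
  by (simp add: sym_subgroup_def group.generate_is_subgroup[OF sym_group_is_group])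

text \<open>Outside the first block \<open>z\<close> is the identity, so the further blocks of
  \<open>x\<close> cancel from the commutator and only two \<open>k\<close>-cycles on
  \<open>{1..k}\<close> remain to be compared. For \<open>k = 3\<close> these would be inverse to
  each other and the commutator trivial.\<close>

lemma tricycle_commutator:
  fixes k q :: nat
  defines "x \<equiv> block_cycle 1 k (Suc q)"
    and "z \<equiv> transpose 1 2 \<circ> interval_cycle 1 k \<circ> transpose 1 2"
  assumes k: "k \<ge> 4"
  shows "tricycle 1 4 2 \<circ> (z \<circ> x) = x \<circ> z"
proof
  fix i
  let ?b = "block_cycle (1 + k) k q"
  obtain k' where k': "k = Suc k'" "k' \<ge> 3" using k by (cases k) auto
  have x: "x i = interval_cycle 1 k (?b i)" for i by (simp add: x_def)
  have b: "?b i = i" if "i \<le> k" for i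
    using that by (simp add: block_cycle_fixes)
  \<comment> \<open>\<open>?b\<close> fixes all points up to \<open>k\<close>, so by injectivity it
    cannot send another point there.\<close>
  have b': "?b i > k" if "i > k"
  proof (rule ccontr)
    assume "\<not> ?b i > k"
    then have "?b (?b i) = ?b i" using b by simp
    then have "?b i = i"
      using permutes_inj[OF block_cycle_permutes, of "1 + k" k q] by (simp add: inj_eq)
    then show False using \<open>\<not> ?b i > k\<close> that by simp
  qed
  show "(tricycle 1 4 2 \<circ> (z \<circ> x)) i = (x \<circ> z) i"
  proof (cases "i \<le> k")
    case True
    have "z i \<le> k"
      using True k' by (auto simp: z_def transpose_def interval_cycle_apply)
    then have "x (z i) = interval_cycle 1 k (z i)" unfolding x using b by simp
    moreover have "x i = interval_cycle 1 k i" unfolding x using b True by simp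
    ultimately show ?thesis
      using True k' by (auto simp: z_def transpose_def interval_cycle_apply)
  next
    case False
    then have "z i = i" "z (?b i) = ?b i" "interval_cycle 1 k (?b i) = ?b i"
      using b' k' by (auto simp: z_def transpose_def interval_cycle_apply)
    with False b' k show ?thesis by (simp add: x transpose_def)
  qed
qed

text \<open>\<open>y\<close> is to serve the points that blocks packed from 1 do not move up: the
  block ends and the remainder. If there is a remainder \<open>r\<close>, blocks packed against
  \<open>n\<close> do this and fix 1. Otherwise one block has no gaps, and several blocks are
  bridged by blocks shifted by one.\<close>

lemma connecting_block_cycle:
  assumes k: "k \<ge> 3" and n: "n \<ge> k"
  obtains y where "y permutes {1..n}" "has_order k y" "odd k \<Longrightarrow> evenperm y" "y 1 \<in> {1, 2}"
    "\<And>i. 1 \<le> i \<Longrightarrow> i < n \<Longrightarrow> k dvd i \<or> n div k * k \<le> i \<Longrightarrow> y i = Suc i"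
proof -
  define q where "q = n div k"
  define r where "r = n mod k"
  have qr: "n = q * k + r" "r < k" "q > 0"
    using k n by (auto simp: q_def r_def div_greater_zero_iff)
  show thesis
  proof (cases "r = 0")
    case False
    show thesis
    proof (rule that[of "block_cycle (Suc r) k q"])
      show "block_cycle (Suc r) k q permutes {1..n}"
        by (rule permutes_subset[OF block_cycle_permutes]) (use qr in auto)
      show "has_order k (block_cycle (Suc r) k q)"
        using qr by (intro has_order_block_cycle)
      show "evenperm (block_cycle (Suc r) k q)" if "odd k"
        using that k by (simp add: evenperm_block_cycle)
      show "block_cycle (Suc r) k q 1 \<in> {1, 2}"
        using False by (simp add: block_cycle_fixes)
      show "block_cycle (Suc r) k q i = Suc i"
        if i: "1 \<le> i" "i < n" "k dvd i \<or> n div k * k \<le> i" for i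
      proof (rule block_cycle_apply)
        have "k \<le> q * k" using qr(3) by (cases q) auto
        with i dvd_imp_le[of k i] have "k \<le> i" unfolding q_def by linarith
        then show "Suc r \<le> i" using qr by simp
        show "Suc i < Suc r + q * k" using i qr by simp
        \<comment> \<open>The block ends of \<open>y\<close> are congruent to \<open>r\<close>
          modulo \<open>k\<close>, so none is a multiple of \<open>k\<close>; those before
          \<open>n\<close> are at most \<open>n - k\<close>, which is less than
          \<open>q * k\<close>.\<close>
        show "\<not> k dvd Suc i - Suc r"
        proof
          assume *: "k dvd Suc i - Suc r"
          then have "k dvd i - r" by simp
          show False
          proof (cases "k dvd i")
            case True
            then have "k dvd i - (i - r)" using \<open>k dvd i - r\<close> by (rule dvd_diff_nat)
            then show False
              using False qr(2) \<open>Suc r \<le> i\<close> by (auto dest: dvd_imp_le)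
          next
            case ndvd: False
            then have "q * k \<le> i" using i by (simp add: q_def)
            obtain m where m: "i - r = k * m" using \<open>k dvd i - r\<close> by blast
            have "i - r < q * k" using i(2) qr(1) \<open>Suc r \<le> i\<close> by linarith
            then have "k * m < k * q" by (simp only: m mult.commute[of q k])
            then have "m < q" by (simp only: mult_less_cancel1)
            then have "Suc m * k \<le> q * k" by (intro mult_right_mono) auto
            then show False using m \<open>q * k \<le> i\<close> qr(2) \<open>Suc r \<le> i\<close> by (simp add: algebra_simps)
          qed
        qed
      qed
    qed
  next
    case r: True
    show thesis
    proof (cases "q = 1")
      case True
      show thesis
      \<comment> \<open>Now \<open>n = k\<close>, so no point below \<open>n\<close> has to be
        bridged; this cycle serves because it sends 1 to 2.\<close>
      proof (rule that[of "block_cycle 1 k 1"])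
        show "block_cycle 1 k 1 permutes {1..n}"
          by (rule permutes_subset[OF block_cycle_permutes]) (use qr r True in auto)
        show "has_order k (block_cycle 1 k 1)" by (intro has_order_block_cycle) simp
        show "evenperm (block_cycle 1 k 1)" if "odd k"
          using that k evenperm_block_cycle[of k 1 1] by simp
        show "block_cycle 1 k 1 1 \<in> {1, 2}"
          using block_cycle_apply[of 1 1 1 k] k by simp
        show "block_cycle 1 k 1 i = Suc i"
          if i: "1 \<le> i" "i < n" "k dvd i \<or> n div k * k \<le> i" for i
        proof -
          have "n = k" using qr(1) r True by simp
          moreover have "k \<le> i" using i dvd_imp_le[of k i] True unfolding q_def by force
          ultimately show ?thesis using i by simp
        qed
      qed
    next
      case False
      then obtain p where p: "q = Suc p" "p > 0" using qr by (cases q) auto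
      show thesis
      \<comment> \<open>The shift by one works because \<open>i\<close> and \<open>i - 1\<close> are
        not both multiples of \<open>k\<close>. One block is dropped to stay within
        \<open>{1..n}\<close>.\<close>
      proof (rule that[of "block_cycle 2 k p"])
        show "block_cycle 2 k p permutes {1..n}"
          by (rule permutes_subset[OF block_cycle_permutes]) (use qr r p k in auto)
        show "has_order k (block_cycle 2 k p)" using p by (intro has_order_block_cycle)
        show "evenperm (block_cycle 2 k p)" if "odd k"
          using that k by (simp add: evenperm_block_cycle)
        show "block_cycle 2 k p 1 \<in> {1, 2}" by (simp add: block_cycle_fixes)
        show "block_cycle 2 k p i = Suc i"
          if i: "1 \<le> i" "i < n" "k dvd i \<or> n div k * k \<le> i" for i
        proof (rule block_cycle_apply)
          have "n = q * k" using qr(1) r by simp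
          then have "k dvd i" using i unfolding q_def by linarith
          then obtain m where m: "i = k * m" by blast
          show "2 \<le> i" using \<open>k dvd i\<close> i k by (auto dest: dvd_imp_le)
          have "k * m < k * Suc p" using m i(2) \<open>n = q * k\<close> p(1) by (simp only: mult.commute)
          then have "m \<le> p" by (simp only: mult_less_cancel1 less_Suc_eq_le)
          then have "k * m \<le> k * p" by simp
          then have "i \<le> p * k" using m by (simp only: mult.commute)
          then show "Suc i < 2 + p * k" by linarith
          show "\<not> k dvd Suc i - 2"
          proof
            assume "k dvd Suc i - 2"
            with \<open>k dvd i\<close> have "k dvd i - (Suc i - 2)" by (rule dvd_diff_nat)
            then show False using \<open>2 \<le> i\<close> k by simp
          qed
        qed
      qed
    qed
  qed
qed

lemma three_generators:
  assumes k: "k \<ge> 3" and n: "n \<ge> k"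
  obtains S where "finite S" "card S \<le> 3" "S \<subseteq> carrier (sym_group n)"
    "\<And>x. x \<in> S \<Longrightarrow> has_order k x" "carrier (alt_group n) \<subseteq> generate (sym_group n) S"
    "even k \<Longrightarrow> \<exists>z\<in>S. \<not> evenperm z" "odd k \<Longrightarrow> S \<subseteq> carrier (alt_group n)"
proof -
  define q where "q = n div k"
  have q: "q * k \<le> n" "q > 0"
    using k n by (auto simp: q_def div_greater_zero_iff)
  then have kqk: "k \<le> q * k" by (cases q) auto
  define x where "x = block_cycle 1 k q"
  define t where "t = transpose (1 :: nat) 2"
  \<comment> \<open>Only one cycle is conjugated, not all of \<open>x\<close>: thus \<open>z\<close>
    is odd for even \<open>k\<close>, whatever the number of blocks in \<open>x\<close>.\<close>
  define z where "z = t \<circ> interval_cycle 1 k \<circ> t"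
  obtain y where y: "y permutes {1..n}" "has_order k y" "odd k \<Longrightarrow> evenperm y" "y 1 \<in> {1, 2}"
    and y_step: "\<And>i. 1 \<le> i \<Longrightarrow> i < n \<Longrightarrow> k dvd i \<or> q * k \<le> i \<Longrightarrow> y i = Suc i"
    using connecting_block_cycle[OF k n] unfolding q_def by blast
  have x: "x permutes {1..n}"
    unfolding x_def by (rule permutes_subset[OF block_cycle_permutes]) (use q in auto)
  have c: "interval_cycle 1 k permutes {1..n}"
    by (rule permutes_subset[OF interval_cycle_permutes]) (use n in auto)
  have t: "t permutes {1..n}"
    unfolding t_def using k n by (intro permutes_swap_id) auto
  have z: "z permutes {1..n}"
    unfolding z_def by (intro permutes_compose c t)
  have z_even: "evenperm z \<longleftrightarrow> odd k"
    using k permutation_interval_cycle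
    by (simp add: z_def t_def evenperm_comp permutation_compose permutation_swap_id evenperm_swap
        evenperm_interval_cycle)
  define S where "S = {x, y, z}"
  have S_sym: "S \<subseteq> carrier (sym_group n)"
    using x y z by (simp add: S_def sym_group_carrier)
  have z_order: "has_order k z"
    unfolding z_def t_def using has_order_block_cycle[of 1 k 1]
    by (intro has_order_conj_involution transpose_comp_involutory) simp
  interpret sym_subgroup n "generate (sym_group n) S"
    by (rule sym_subgroup_generate[OF S_sym])
  have gen: "x \<in> generate (sym_group n) S" "y \<in> generate (sym_group n) S"
    "z \<in> generate (sym_group n) S"
    by (auto simp: S_def intro: generate.incl)
  have "linked 1 2"
  proof (cases "k = 3")
    case True
    \<comment> \<open>The commutator is of no help for \<open>k = 3\<close>, but then
      \<open>z\<close> itself is a three-cycle.\<close>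
    have "tricycle 1 3 2 = z"
      using interval_cycle_apply[of 1 2] True
      by (auto simp: z_def t_def fun_eq_iff transpose_def numeral_3_eq_3 numeral_2_eq_2)
    then have "tri 1 3 2" using gen(3) by (simp add: tri_def del: cycle_of_list.simps)
    then show ?thesis using tri_rotate tri_swap unfolding linked_def by blast
  next
    case False
    obtain p where "q = Suc p" using q by (cases q) auto
    then have "tricycle 1 4 2 \<circ> (z \<circ> x) = x \<circ> z"
      using False k tricycle_commutator[of k p] by (simp add: x_def z_def t_def)
    then have "tricycle 1 4 2 \<in> generate (sym_group n) S"
      by (rule in_if_comp_eq[rotated 2]) (intro comp_closed gen)+
    then have "tri 1 4 2" by (simp add: tri_def del: cycle_of_list.simps)
    then show ?thesis using tri_rotate tri_swap unfolding linked_def by blast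
  qed
  moreover have "\<exists>g\<in>generate (sym_group n) S. g 1 \<in> {1, 2} \<and> g i = Suc i"
    if i: "1 \<le> i" "i < n" for i
  proof (cases "k dvd i \<or> q * k \<le> i")
    case True
    then show ?thesis using y_step[OF i] y(4) gen(2) by blast
  next
    case False
    then have "Suc i < 1 + q * k" by simp
    with False i have "x i = Suc i" unfolding x_def by (intro block_cycle_apply) auto
    moreover have "x 1 = 2"
      using block_cycle_apply[of 1 1 q k] k kqk by (simp add: x_def)
    ultimately show ?thesis using gen(1) by blast
  qed
  ultimately have "carrier (alt_group n) \<subseteq> generate (sym_group n) S"
    by (rule alt_group_subset)
  moreover have "S \<subseteq> carrier (alt_group n)" if "odd k"
    using that x y z k z_even by (simp add: S_def x_def alt_group_carrier evenperm_block_cycle)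
  moreover have "card S \<le> 3" by (simp add: S_def card_insert_if)
  moreover have "has_order k g" if "g \<in> S" for g
    using that y z_order has_order_block_cycle[OF q(2)] unfolding S_def x_def by blast
  moreover have "finite S" "\<exists>g\<in>S. evenperm g = odd k"
    using z_even by (simp_all add: S_def)
  ultimately show thesis
    using that[of S] S_sym by blast
qed

section \<open>Four even generators for even order\<close>

text \<open>The fourth generator is the conjugate of \<open>x\<close> by the transposition
  \<open>t\<close>. Its quotient by \<open>x\<close> is a three-cycle linking 1 and 2, and
  conjugation keeps it even and of order \<open>k\<close> although \<open>t\<close> is odd.\<close>

lemma four_generators_alt_aux:
  fixes x y w :: "nat \<Rightarrow> nat"
  defines "t \<equiv> transpose (1 :: nat) 2"
  assumes k: "k > 0" and n: "n \<ge> 3"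
    and x: "x 1 = 2" "x 2 = 3"
    and y1: "y 1 \<in> {1, 2}" and w1: "w 1 \<in> {1, 2}"
    and perm: "\<And>g. g \<in> {x, y, w} \<Longrightarrow> g permutes {1..n} \<and> evenperm g \<and> has_order k g"
    and step: "\<And>i. 1 \<le> i \<Longrightarrow> i < n \<Longrightarrow> x i = Suc i \<or> y i = Suc i \<or> w i = Suc i"
  shows "elements_of_order_suffice 4 k (alt_group n)"
proof (rule elements_of_order_suffice_alt[where S = "{x, y, w, t \<circ> x \<circ> t}"])
  let ?S = "{x, y, w, t \<circ> x \<circ> t}"
  have t: "t permutes {1..n}"
    unfolding t_def using n by (intro permutes_swap_id) auto
  have x_perm: "permutation x"
    using perm[of x] by (auto simp: permutation_permutes)
  have "t \<circ> x \<circ> t permutes {1..n}"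
    using perm[of x] t by (intro permutes_compose) auto
  moreover have "evenperm (t \<circ> x \<circ> t)"
    using perm[of x] x_perm
    by (simp add: t_def evenperm_comp permutation_compose permutation_swap_id evenperm_swap)
  ultimately show S: "?S \<subseteq> carrier (alt_group n)"
    using perm by (simp add: alt_group_carrier)
  show "has_order k g" if "g \<in> ?S" for g
    using that perm has_order_conj_involution[of t k x] by (auto simp: t_def)
  have "?S \<subseteq> carrier (sym_group n)"
    using S by (auto simp: alt_group_carrier sym_group_carrier)
  then interpret sym_subgroup n "generate (sym_group n) ?S"
    by (rule sym_subgroup_generate)
  have gen: "g \<in> generate (sym_group n) ?S" if "g \<in> ?S" for g
    using that by (rule generate.incl)
  have "tricycle 1 2 3 \<circ> x = t \<circ> x \<circ> t"
    unfolding t_def using x perm[of x] by (intro conj_transpose_eq) (auto dest: permutes_bij)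
  then have "tri 1 2 3"
    using in_if_comp_eq[of x "t \<circ> x \<circ> t" "tricycle 1 2 3"] gen
    by (simp add: tri_def del: cycle_of_list.simps)
  then have "linked 1 2" by (auto simp: linked_def)
  then show "carrier (alt_group n) \<subseteq> generate (sym_group n) ?S"
  proof (rule alt_group_subset)
    fix i assume i: "1 \<le> i" "i < n"
    from step[OF this] x(1) y1 w1 obtain g where "g \<in> {x, y, w}" "g 1 \<in> {1, 2}" "g i = Suc i"
      by blast
    then show "\<exists>g\<in>generate (sym_group n) ?S. g 1 \<in> {1, 2} \<and> g i = Suc i"
      using gen by blast
  qed
qed (use k in \<open>simp_all add: card_insert_if\<close>)

lemma four_generators_alt_small:
  assumes k: "k \<ge> 3" "even k" and n: "n \<ge> k + 2" "n < 2 * k"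
  shows "elements_of_order_suffice 4 k (alt_group n)"
proof -
  \<comment> \<open>A single \<open>k\<close>-cycle is odd, so each generator carries a
    transposition. The bound \<open>2 \<le> r\<close> leaves room for it: above the block of
    \<open>x\<close>, and below that of \<open>y\<close>.\<close>
  define r where "r = n - k"
  have r: "n = k + r" "2 \<le> r" "r < k" using n by (auto simp: r_def)
  let ?x = "block_cycle 1 k 1 \<circ> transpose (k + 1) (k + 2)"
  let ?y = "block_cycle (Suc r) k 1 \<circ> transpose 1 2"
  have step_x: "?x i = Suc i" if "1 \<le> i" "i < k" for i
    using that by (intro block_cycle_transpose_apply) (auto dest: dvd_imp_le)
  have y1: "?y 1 = 2" using r by (simp add: block_cycle_fixes del: block_cycle.simps)
  have "?x permutes {1..n}"
    by (intro permutes_compose permutes_swap_id permutes_subset[OF block_cycle_permutes])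
      (use r in auto)
  moreover have "?y permutes {1..n}"
    by (intro permutes_compose permutes_swap_id permutes_subset[OF block_cycle_permutes])
      (use r in auto)
  moreover have "has_order k ?x"
    using k by (intro has_order_block_cycle_transpose) auto
  moreover have "has_order k ?y"
    using k r by (intro has_order_block_cycle_transpose) auto
  moreover have "evenperm ?x"
    using k evenperm_block_cycle_transpose[of k "k + 1" "k + 2" 1 1] by simp
  moreover have "evenperm ?y"
    using k evenperm_block_cycle_transpose[of k 1 2 "Suc r" 1] by simp
  \<comment> \<open>Two elements already bridge everything, so \<open>?y\<close> also fills the role
    of \<open>w\<close>.\<close>
  ultimately have perm: "g permutes {1..n} \<and> evenperm g \<and> has_order k g"
    if "g \<in> {?x, ?y, ?y}" for g
    using that by blast
  show ?thesis
  proof (rule four_generators_alt_aux[OF _ _ _ _ _ _ perm])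
    show "?x 1 = 2" "?x 2 = 3" using step_x[of 1] step_x[of 2] k by simp_all
    show "?x i = Suc i \<or> ?y i = Suc i \<or> ?y i = Suc i" if i: "1 \<le> i" "i < n" for i
    proof (cases "i < k")
      case True
      then show ?thesis using step_x i by blast
    next
      case False
      \<comment> \<open>From \<open>r < k \<le> i\<close> the point \<open>i\<close> lies in the
        block of \<open>y\<close>, and it differs from 1 and 2.\<close>
      have "?y i = Suc i"
        by (rule block_cycle_transpose_apply) (use False i r in \<open>auto dest: dvd_imp_le\<close>)
      then show ?thesis by blast
    qed
  qed (use k n y1 in auto)
qed

text \<open>Here \<^term>\<open>x\<close> and \<^term>\<open>w\<close> consist of cycles packed from the left and from the right end
  of the interval from 1 to \<^term>\<open>n\<close>. The cycles of \<^term>\<open>y\<close> bridge the gaps between those of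
  \<^term>\<open>x\<close>, and its transposition bridges the gap between the two cycles of \<^term>\<open>w\<close> where
  \<^term>\<open>x\<close> does not.\<close>

lemma four_generators_alt_large:
  assumes k: "k \<ge> 3" "even k" and n: "n \<ge> 2 * k"
  shows "elements_of_order_suffice 4 k (alt_group n)"
proof -
  \<comment> \<open>Parity dictates the block counts: \<open>x\<close> gets the even number
    \<open>2 * Q\<close>, and \<open>y\<close> gets the odd number \<open>m = 2 * Q - 1\<close>,
    made even by its transposition.\<close>
  define Q where "Q = n div (2 * k)"
  have "Q > 0" using k n by (simp add: Q_def div_greater_zero_iff)
  have "n = Q * (2 * k) + n mod (2 * k)"
    unfolding Q_def by (rule div_mult_mod_eq[symmetric])
  moreover have "n mod (2 * k) < 2 * k" using k by simp
  ultimately have nQ: "Q * (2 * k) \<le> n" "n < Q * (2 * k) + 2 * k" by linarith+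
  define m where "m = 2 * Q - 1"
  have m: "odd m" "m > 0" "2 * Q = Suc m" using \<open>Q > 0\<close> by (auto simp: m_def)
  have "Q * (2 * k) = Suc m * k" using m(3) by (metis mult.assoc mult.commute)
  then have nm: "m * k + k \<le> n" "n < m * k + 3 * k" using nQ by simp_all
  have kmk: "k \<le> m * k" using m(2) by (cases m) auto
  \<comment> \<open>The transposition must lie above the blocks of \<open>y\<close>. The end
    \<open>n - k\<close> of the first block of \<open>w\<close> qualifies if
    \<open>n > m * k + k + 1\<close>; otherwise that point lies below \<open>m * k + k\<close>,
    where \<open>x\<close> and the blocks of \<open>y\<close> suffice, and \<open>n - 1\<close> is a
    harmless default.\<close>
  define t where "t = (if n > m * k + k + 1 then n - k else n - 1)"
  have t: "2 + m * k \<le> t" "Suc t \<le> n" using nm k kmk by (auto simp: t_def)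
  \<comment> \<open>The two blocks of \<open>w\<close> end at \<open>n\<close>. As
    \<open>n < m * k + 3 * k\<close>, they contain all points from \<open>m * k + k\<close> to
    \<open>n\<close>.\<close>
  define s where "s = Suc (n - 2 * k)"
  let ?x = "block_cycle 1 k (Suc m)"
  let ?w = "block_cycle s k 2"
  let ?y = "block_cycle 2 k m \<circ> transpose t (Suc t)"
  have x_step: "?x i = Suc i" if "1 \<le> i" "i < m * k + k" "\<not> k dvd i" for i
    using that by (intro block_cycle_apply) auto
  have "?x permutes {1..n}"
    by (rule permutes_subset[OF block_cycle_permutes]) (use nm in auto)
  moreover have "?w permutes {1..n}"
    by (rule permutes_subset[OF block_cycle_permutes]) (use n in \<open>auto simp: s_def\<close>)
  moreover have "?y permutes {1..n}"
    by (intro permutes_compose permutes_swap_id permutes_subset[OF block_cycle_permutes])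
      (use t nm k in auto)
  moreover have "has_order k ?x" "has_order k ?w" by (rule has_order_block_cycle; simp)+
  moreover have "has_order k ?y"
    using k m t by (intro has_order_block_cycle_transpose) auto
  moreover have "evenperm ?x" "evenperm ?w"
    using k m evenperm_block_cycle[of k 1 "Suc m"] evenperm_block_cycle[of k s 2] by simp_all
  moreover have "evenperm ?y"
    using k m by (intro evenperm_block_cycle_transpose[THEN iffD2]) auto
  ultimately have perm: "g permutes {1..n} \<and> evenperm g \<and> has_order k g"
    if "g \<in> {?x, ?y, ?w}" for g
    using that by blast
  show ?thesis
  proof (rule four_generators_alt_aux[OF _ _ _ _ _ _ perm])
    show "?x 1 = 2" "?x 2 = 3"
      using x_step[of 1] x_step[of 2] k kmk by (auto dest: dvd_imp_le)
    show "?y 1 \<in> {1, 2}" using t by (simp add: block_cycle_fixes)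
    show "?w 1 \<in> {1, 2}"
    proof (cases "n = 2 * k")
      case True
      then show ?thesis using block_cycle_apply[of 1 1 2 k] k by (simp add: s_def)
    next
      case False
      then have "?w 1 = 1" using n by (intro block_cycle_fixes) (simp add: s_def)
      then show ?thesis by simp
    qed
    show "?x i = Suc i \<or> ?y i = Suc i \<or> ?w i = Suc i" if i: "1 \<le> i" "i < n" for i
    proof (cases "i < m * k + k")
      case low: True
      show ?thesis
      proof (cases "k dvd i")
        case False
        then show ?thesis using x_step low i by blast
      next
        case True
        then obtain j where j: "i = k * j" by blast
        then have "k * j < k * Suc m" using low by (simp add: algebra_simps)
        then have "j \<le> m" by (simp only: mult_less_cancel1 less_Suc_eq_le)
        then have "k * j \<le> k * m" by simp
        then have im: "i \<le> m * k" using j by (simp add: algebra_simps)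
        have "k \<le> i" using True i by (auto dest: dvd_imp_le)
        \<comment> \<open>The block ends of \<open>x\<close> are multiples of \<open>k\<close>,
          those of \<open>y\<close> exceed such multiples by one.\<close>
        have "\<not> k dvd Suc i - 2"
        proof
          assume "k dvd Suc i - 2"
          with True have "k dvd i - (Suc i - 2)" by (rule dvd_diff_nat)
          then show False using \<open>k \<le> i\<close> k by simp
        qed
        then have "?y i = Suc i"
          using im t k \<open>k \<le> i\<close> by (intro block_cycle_transpose_apply) auto
        then show ?thesis by blast
      qed
    next
      case high: False
      show ?thesis
      proof (cases "i = n - k")
        case True
        then have "t = i" using high k by (auto simp: t_def)
        then have "?y i = Suc i" using t by (simp add: block_cycle_fixes)
        then show ?thesis by blast
      next
        case False
        \<comment> \<open>The position of \<open>Suc i\<close> relative to the start of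
          \<open>w\<close>. Its only possible value divisible by \<open>k\<close> is
          \<open>k\<close> itself, which belongs to the excluded point \<open>n - k\<close>.\<close>
        define d where "d = i - (n - 2 * k)"
        have d: "0 < d" "d < 2 * k" "d \<noteq> k" "Suc i - s = d"
          using False high nm i n by (auto simp: d_def s_def)
        have "\<not> k dvd d"
        proof
          assume "k dvd d"
          then obtain j where j: "d = k * j" by blast
          with d have "j < 2" "j \<noteq> 0" "j \<noteq> 1" by (auto simp: mult.commute)
          then show False by simp
        qed
        then have "?w i = Suc i"
          using d i n by (intro block_cycle_apply) (auto simp: s_def)
        then show ?thesis by blast
      qed
    qed
  qed (use k n in auto)
qed

theorem theorem1p2:
  shows "(\<forall>k n :: nat. k \<ge> 3 \<and> n \<ge> k \<longrightarrow>
            (even k \<longrightarrow> elements_of_order_suffice 3 k (sym_group n)) \<and>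
            (odd k \<longrightarrow> elements_of_order_suffice 3 k (alt_group n))) \<and>
         (\<forall>k n :: nat. k \<ge> 3 \<and> n \<ge> k + 2 \<longrightarrow>
            (even k \<longrightarrow> elements_of_order_suffice 4 k (alt_group n)))"
proof (intro conjI allI impI; elim conjE)
  fix k n :: nat assume "3 \<le> k" "k \<le> n" "even k"
  then obtain S where S: "finite S" "card S \<le> 3" "S \<subseteq> carrier (sym_group n)"
    "\<And>x. x \<in> S \<Longrightarrow> has_order k x" "carrier (alt_group n) \<subseteq> generate (sym_group n) S"
    "\<exists>z\<in>S. \<not> evenperm z"
    using three_generators by metis
  interpret sym_subgroup n "generate (sym_group n) S"
    by (rule sym_subgroup_generate[OF S(3)])
  \<comment> \<open>The odd generator enlarges the alternating group to the whole symmetric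
    group.\<close>
  have "carrier (sym_group n) \<subseteq> generate (sym_group n) S"
    using S(6) sym_group_subset_if_odd[OF S(5)] generate.incl[of _ S] by blast
  then show "elements_of_order_suffice 3 k (sym_group n)"
    using S \<open>3 \<le> k\<close> by (intro elements_of_order_suffice_sym[of S]) auto
next
  fix k n :: nat assume "3 \<le> k" "k \<le> n" "odd k"
  then obtain S where S: "finite S" "card S \<le> 3" "S \<subseteq> carrier (alt_group n)"
    "\<And>x. x \<in> S \<Longrightarrow> has_order k x" "carrier (alt_group n) \<subseteq> generate (sym_group n) S"
    using three_generators by metis
  then show "elements_of_order_suffice 3 k (alt_group n)"
    using \<open>3 \<le> k\<close> by (intro elements_of_order_suffice_alt[of S]) auto
next
  fix k n :: nat assume "3 \<le> k" "k + 2 \<le> n" "even k"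
  then show "elements_of_order_suffice 4 k (alt_group n)"
    using four_generators_alt_small four_generators_alt_large by (meson not_less)
qed

end
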